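(* Let $G=(\vec{Q},T)$ be a witness graph for a VAS $\vec{A}\subseteq\mathbb{Z}^d$, and let $q=|\vec{Q}|$ and $a=\|\vec{A}\|_\infty$. Then every vector $\vec{z}\in\vec{Z}_G$ is the displacement of a Kirchhoff function $\mu$ for $G$ satisfying $$\|\mu\|_\infty\leq \big(q^{d+1}a(1+2a)^d+m\big)^d,$$ where $m=\|\vec{z}\|_\infty$.
   Context: Let $\star$ be a new symbol, $\mathbb{N}_\star=\mathbb{N}\cup\{\star\}$; for $I\subseteq\{1,\ldots,d\}$, $\mathbb{N}_I^d$ is the set of $\vec{c}\in\mathbb{N}_\star^d$ with $\{i\mid\vec{c}(i)=\star\}=I$. For $\vec{a}\in\mathbb{Z}^d$, $\pi_I(\vec{a})$ replaces the components in $I$ by $\star$, and addition on vectors with the same $\star$-components is componentwise on the other components. A VAS is a finite $\vec{A}\subseteq\mathbb{Z}^d$, $\|\vec{A}\|_\infty=\max_{\vec{a}\in\vec{A}}\max_i|\vec{a}(i)|$ ($0$ if empty), and for $\vec{z}\in\mathbb{Z}^d$, $\|\vec{z}\|_\infty=\max_i|\vec{z}(i)|$. A subreachability graph is $G=(\vec{Q},T)$ with $\vec{Q}\subseteq\mathbb{N}_I^d$ a nonempty finite set of states and $T\subseteq\vec{Q}\times\vec{A}\times\vec{Q}$ a finite set of transitions $(\vec{x},\vec{a},\vec{y})$ with $\vec{y}=\vec{x}+\pi_I(\vec{a})$; a witness graph is a strongly connected subreachability graph. A cycle in $G$ labelled by $\sigma=\vec{a}_1\cdots\vec{a}_k$ is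 a sequence of transitions $(\vec{c}_{j-1},\vec{a}_j,\vec{c}_j)\in T$, $j=1,\ldots,k$, with $\vec{c}_0=\vec{c}_k$. $\vec{Z}_G\subseteq\mathbb{Z}^d$ is the set of finite sums of vectors $\Delta(\sigma)=\sum_j\vec{a}_j$ where $\sigma$ labels a cycle in $G$. A Kirchhoff function for $G$ is $\mu:T\to\mathbb{N}$ such that for every state $\vec{x}$, the sum of $\mu(t)$ over transitions $t$ entering $\vec{x}$ equals the sum over transitions leaving $\vec{x}$; its displacement is $\sum_{t=(\vec{x},\vec{a},\vec{y})\in T}\mu(t)\vec{a}$, and $\|\mu\|_\infty=\max_{t\in T}\mu(t)$. *)

theory Defs
  imports "HOL-Analysis.Finite_Cartesian_Product" "Graph_Theory.Digraph_Component"
begin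

text \<open>
  Integer vectors of dimension \<open>d\<close> are elements of \<open>int ^ 'd\<close> with \<open>d = CARD('d)\<close>.
  A vector with star components has entries in \<open>int option\<close>, where \<open>None\<close> is the
  star symbol.
\<close>

type_synonym 'd star_vec = "(int option) ^ 'd"

type_synonym 'd transition = "'d star_vec \<times> (int ^ 'd) \<times> 'd star_vec"

text \<open>The set of vectors over the naturals whose star components are exactly those in \<open>I\<close>.\<close>

definition nat_star_vecs :: "'d::finite set \<Rightarrow> 'd star_vec set" where
  "nat_star_vecs I = {c. {i. c $ i = None} = I \<and> (\<forall>i n. c $ i = Some n \<longrightarrow> n \<ge> 0)}"

definition star_proj :: "'d::finite set \<Rightarrow> int ^ 'd \<Rightarrow> 'd star_vec" where
  "star_proj I a = (\<chi> i. if i \<in> I then None else Some (a $ i))"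

text \<open>Only used for two vectors with the same star components.\<close>

definition star_add :: "'d::finite star_vec \<Rightarrow> 'd star_vec \<Rightarrow> 'd star_vec" where
  "star_add x y = (\<chi> i. case (x $ i, y $ i) of (Some m, Some n) \<Rightarrow> Some (m + n) | _ \<Rightarrow> None)"

definition vec_norm :: "int ^ 'd::finite \<Rightarrow> nat" where
  "vec_norm z = Max (range (\<lambda>i. nat \<bar>z $ i\<bar>))"

definition vas_norm :: "(int ^ 'd::finite) set \<Rightarrow> nat" where
  "vas_norm A = (if A = {} then 0 else Max (vec_norm ` A))"

definition subreachability_graph ::
  "(int ^ 'd::finite) set \<Rightarrow> 'd star_vec set \<Rightarrow> 'd transition set \<Rightarrow> bool" where
  "subreachability_graph A Q T \<longleftrightarrow>
     finite Q \<and> Q \<noteq> {} \<and> finite T \<and>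
     (\<exists>I. Q \<subseteq> nat_star_vecs I \<and>
       (\<forall>(x, a, y) \<in> T. x \<in> Q \<and> a \<in> A \<and> y \<in> Q \<and> y = star_add x (star_proj I a)))"

definition graph_of ::
  "'d star_vec set \<Rightarrow> 'd transition set \<Rightarrow> ('d star_vec, 'd transition) pre_digraph" where
  "graph_of Q T = \<lparr>verts = Q, arcs = T, tail = (\<lambda>(x, a, y). x), head = (\<lambda>(x, a, y). y)\<rparr>"

definition transition_label :: "'d transition \<Rightarrow> int ^ 'd" where
  "transition_label = (\<lambda>(x, a, y). a)"

definition witness_graph ::
  "(int ^ 'd::finite) set \<Rightarrow> 'd star_vec set \<Rightarrow> 'd transition set \<Rightarrow> bool" where
  "witness_graph A Q T \<longleftrightarrow> subreachability_graph A Q T \<and> strongly_connected (graph_of Q T)"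

text \<open>
  A cycle is a closed walk, not necessarily simple; the empty walk at a state counts as a
  cycle labelled by the empty word.
\<close>

definition labels_cycle ::
  "'d star_vec set \<Rightarrow> 'd transition set \<Rightarrow> (int ^ 'd) list \<Rightarrow> bool" where
  "labels_cycle Q T \<sigma> \<longleftrightarrow>
     (\<exists>c p. pre_digraph.awalk (graph_of Q T) c p c \<and> map transition_label p = \<sigma>)"

definition cycle_sums ::
  "'d::finite star_vec set \<Rightarrow> 'd transition set \<Rightarrow> (int ^ 'd) set" where
  "cycle_sums Q T = {\<Sum>\<sigma>\<leftarrow>\<sigma>s. sum_list \<sigma> |\<sigma>s. \<forall>\<sigma> \<in> set \<sigma>s. labels_cycle Q T \<sigma>}"

text \<open>
  Kirchhoff functions are total functions on triples; their values outside \<open>T\<close> are irrelevant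
  to all notions below.
\<close>

definition kirchhoff_function ::
  "'d star_vec set \<Rightarrow> 'd transition set \<Rightarrow> ('d transition \<Rightarrow> nat) \<Rightarrow> bool" where
  "kirchhoff_function Q T \<mu> \<longleftrightarrow>
     (\<forall>x \<in> Q. (\<Sum>t \<in> in_arcs (graph_of Q T) x. \<mu> t) = (\<Sum>t \<in> out_arcs (graph_of Q T) x. \<mu> t))"

definition displacement ::
  "'d::finite transition set \<Rightarrow> ('d transition \<Rightarrow> nat) \<Rightarrow> int ^ 'd" where
  "displacement T \<mu> = (\<Sum>t \<in> T. int (\<mu> t) *s transition_label t)"

definition kirchhoff_norm :: "'d transition set \<Rightarrow> ('d transition \<Rightarrow> nat) \<Rightarrow> nat" where
  "kirchhoff_norm T \<mu> = (if T = {} then 0 else Max (\<mu> ` T))"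

end

theory Submission
  imports Defs "HOL-Library.Multiset"
begin

text \<open>
  A vector of \<open>cycle_sums Q T\<close> is a sum of nonzero displacements of simple cycles, taken from
  the finite set \<open>V\<close> of all such displacements, which lies in the box \<open>[-qa, qa]\<^sup>d\<close>.
  Following Pottier, take a shortest such sum and order its terms so that every partial sum
  stays near the segment from \<open>0\<close> to \<open>z\<close>. By minimality the partial sums are distinct, since
  the terms between two equal ones could be dropped, so the number of terms is smaller than the number
  of integer points of the box around the segment containing them. One simple cycle
  for each term gives the Kirchhoff function. Leaving out the zero vector, \<open>V\<close> has fewer than
  \<open>(1 + 2qa)\<^sup>d\<close> elements, which absorbs the summand \<open>1\<close> in Pottier's bound.
\<close>

section \<open>Balanced orderings of a multiset of vectors\<close>

text \<open>
  The next element appended is one minimizing \<open>(c v + 1) / L v\<close> for the current counts \<open>c\<close>;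
  this minimum is the new \<open>t\<close>.
\<close>

lemma balanced_prefixes:
  fixes L :: "'v \<Rightarrow> nat"
  assumes "finite V" "k \<le> (\<Sum>v\<in>V. L v)"
  shows "\<exists>xs. length xs = k \<and> set xs \<subseteq> V \<and> (\<forall>v\<in>V. count_list xs v \<le> L v) \<and>
    (\<forall>i\<le>k. \<exists>t\<in>{0..1::real}. \<forall>v\<in>V. real (count_list (take i xs) v) \<le> t * L v \<and>
       t * L v \<le> real (count_list (take i xs) v) + 1)"
  using assms(2)
proof (induction k)
  case 0
  show ?case by (intro exI[of _ "[]"]) (auto intro!: bexI[of _ 0])
next
  case (Suc k)
  then obtain xs where xs: "length xs = k" "set xs \<subseteq> V" "\<forall>v\<in>V. count_list xs v \<le> L v"
    "\<forall>i\<le>k. \<exists>t\<in>{0..1::real}. \<forall>v\<in>V. real (count_list (take i xs) v) \<le> t * L v \<and>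
       t * L v \<le> real (count_list (take i xs) v) + 1"
    by auto
  let ?c = "count_list xs"
  obtain t where t: "t \<in> {0..1::real}" "\<forall>v\<in>V. real (?c v) \<le> t * L v \<and> t * L v \<le> real (?c v) + 1"
    using xs(4)[rule_format, of k] xs(1) by auto
  define U where "U = {v\<in>V. ?c v < L v}"
  define r where "r v = (real (?c v) + 1) / L v" for v
  have "finite U" using assms(1) by (auto simp: U_def)
  moreover have "U \<noteq> {}"
  proof
    assume "U = {}"
    then have "(\<Sum>v\<in>V. L v) \<le> (\<Sum>v\<in>V. ?c v)"
      by (intro sum_mono) (force simp: U_def)
    also have "\<dots> = (\<Sum>v\<in>set xs. ?c v)"
      using xs(2) assms(1) by (intro sum.mono_neutral_right) (auto simp: count_list_0_iff)
    also have "\<dots> = k" using xs(1) by (simp add: sum_count_set)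
    finally show False using Suc.prems by simp
  qed
  ultimately obtain v where v: "v \<in> U" "\<And>u. u \<in> U \<Longrightarrow> r v \<le> r u"
    using ex_min_if_finite[of "r ` U"] by (metis (no_types, lifting) finite_imageI image_iff image_is_empty linorder_not_less)
  have vV: "v \<in> V" "?c v < L v" using v(1) by (auto simp: U_def)
  have rv: "r v * L v = real (?c v) + 1" using vV by (simp add: r_def)
  have r1: "0 \<le> r v" "r v \<le> 1" using vV by (auto simp: r_def)
  \<comment> \<open>The upper inequality at the old \<open>t\<close> says that \<open>t\<close> is
    at most \<open>(?c v + 1) / L v\<close>. So the parameter never decreases, and the upper bounds
    on the counts of the other elements persist.\<close>
  have "t * L v \<le> r v * L v" using t(2) vV rv by simp
  then have tr: "t \<le> r v" using vV by simp
  let ?xs = "xs @ [v]"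
  have step: "real (count_list ?xs u) \<le> r v * L u \<and> r v * L u \<le> real (count_list ?xs u) + 1"
    if u: "u \<in> V" for u
  proof (cases "u = v")
    case True
    then show ?thesis using rv by simp
  next
    case False
    have "real (?c u) \<le> t * L u" using t(2) u by blast
    also have "\<dots> \<le> r v * L u" using tr by (simp add: mult_right_mono)
    finally have 1: "real (?c u) \<le> r v * L u" .
    have 2: "r v * L u \<le> real (?c u) + 1"
    proof (cases "?c u < L u")
      case True
      then have "r v \<le> r u" using v(2) u by (auto simp: U_def)
      then have "r v * L u \<le> r u * L u" by (simp add: mult_right_mono)
      also have "\<dots> = real (?c u) + 1" using True by (simp add: r_def)
      finally show ?thesis .
    next
      case False
      \<comment> \<open>An exhausted element takes no part in the minimization; for it
        \<open>r v \<le> 1\<close> is enough.\<close>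
      then have "?c u = L u" using xs(3) u by force
      then show ?thesis using r1 mult_right_mono[of "r v" 1 "real (L u)"] by simp
    qed
    show ?thesis using 1 2 False by simp
  qed
  show ?case
  proof (intro exI[of _ ?xs] conjI allI impI)
    show "length ?xs = Suc k" using xs by simp
    show "set ?xs \<subseteq> V" using xs vV by simp
    show "\<forall>u\<in>V. count_list ?xs u \<le> L u" using xs(3) vV by auto
    fix i assume "i \<le> Suc k"
    show "\<exists>t\<in>{0..1::real}. \<forall>v\<in>V. real (count_list (take i ?xs) v) \<le> t * L v \<and>
       t * L v \<le> real (count_list (take i ?xs) v) + 1"
    proof (cases "i = Suc k")
      case True
      then have "take i ?xs = ?xs" using xs(1) by simp
      then show ?thesis using step r1 by (intro bexI[of _ "r v"]) auto
    next
      case False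
      then have "i \<le> k" using \<open>i \<le> Suc k\<close> by simp
      then show ?thesis using xs(1) xs(4) by simp
    qed
  qed
qed

section \<open>Short representations of a sum of vectors\<close>

text \<open>Grouping equal terms makes each coordinate linear in the counts, so that a partial sum
  can be compared with \<open>t\<close> times the whole sum.\<close>

lemma sum_list_component_count:
  fixes xs :: "(int ^ 'd::finite) list"
  assumes "finite V" "set xs \<subseteq> V"
  shows "sum_list xs $ k = (\<Sum>v\<in>V. int (count_list xs v) * v $ k)"
  using assms(2)
proof (induction xs)
  case (Cons x xs)
  have "(\<Sum>v\<in>V. int (count_list (x # xs) v) * v $ k) =
    (\<Sum>v\<in>V. (if v = x then v $ k else 0) + int (count_list xs v) * v $ k)"
    by (intro sum.cong) (auto simp: algebra_simps)
  also have "\<dots> = x $ k + sum_list xs $ k"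
    using Cons assms(1) by (simp add: sum.distrib)
  finally show ?case by simp
qed simp

text \<open>Vectors in the box correspond to coordinate functions in a dependent product of
  intervals. The count serves twice: for the partial sums, and for the set of possible cycle
  displacements.\<close>

lemma card_int_vec_box:
  fixes lo hi :: "'d::finite \<Rightarrow> int"
  shows "finite {x :: int ^ 'd. \<forall>k. x $ k \<in> {lo k..hi k}}"
    and "card {x :: int ^ 'd. \<forall>k. x $ k \<in> {lo k..hi k}} \<le> (\<Prod>k\<in>UNIV. nat (hi k - lo k + 1))"
proof -
  let ?P = "PiE (UNIV :: 'd set) (\<lambda>k. {lo k..hi k})"
  have eq: "{x :: int ^ 'd. \<forall>k. x $ k \<in> {lo k..hi k}} = vec_lambda ` ?P"
  proof (intro subset_antisym subsetI)
    fix x :: "int ^ 'd" assume "x \<in> {x. \<forall>k. x $ k \<in> {lo k..hi k}}"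
    then show "x \<in> vec_lambda ` ?P" by (intro image_eqI[of _ _ "vec_nth x"]) auto
  qed auto
  have fin: "finite ?P" by (intro finite_PiE) auto
  show "finite {x :: int ^ 'd. \<forall>k. x $ k \<in> {lo k..hi k}}" unfolding eq using fin by simp
  have "card (vec_lambda ` ?P) \<le> card ?P" using fin by (rule card_image_le)
  also have "\<dots> = (\<Prod>k\<in>UNIV. nat (hi k - lo k + 1))"
    by (simp add: card_PiE algebra_simps)
  finally show "card {x :: int ^ 'd. \<forall>k. x $ k \<in> {lo k..hi k}} \<le> (\<Prod>k\<in>UNIV. nat (hi k - lo k + 1))"
    unfolding eq .
qed

text \<open>The point \<open>t * z\<close> lies between \<open>0\<close> and \<open>z\<close>
  whatever the sign of \<open>z\<close>, and \<open>s\<close> deviates from it by at most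
  \<open>p\<close> downwards and \<open>n\<close> upwards.\<close>

lemma between_scaled_bounds:
  fixes t z s p n :: real
  assumes "t \<in> {0..1}" "- p \<le> s - t * z" "s - t * z \<le> n"
  shows "min 0 z - p \<le> s" "s \<le> max 0 z + n"
proof -
  have "min 0 z \<le> t * z" "t * z \<le> max 0 z"
    using assms(1) mult_left_le_one_le[of z t] mult_left_le_one_le[of "- z" t]
    by (auto simp: min_def max_def mult_nonneg_nonpos)
  then show "min 0 z - p \<le> s" "s \<le> max 0 z + n" using assms by linarith+
qed

text \<open>In coordinate \<open>k\<close> the box containing the partial sums needs length
  \<open>\<bar>sum_list zs $ k\<bar>\<close> for the segment and
  \<open>\<Sum>v\<in>V. \<bar>v $ k\<bar>\<close> for the deviations from it; the \<open>1\<close>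
  counts both end points.\<close>

lemma short_representation:
  fixes zs :: "(int ^ 'd::finite) list"
  assumes fV: "finite V" and zs: "set zs \<subseteq> V"
  shows "\<exists>ys. set ys \<subseteq> V \<and> sum_list ys = sum_list zs \<and>
    length ys < (\<Prod>k\<in>UNIV. nat (1 + (\<Sum>v\<in>V. \<bar>v $ k\<bar>) + \<bar>sum_list zs $ k\<bar>))"
proof -
  define z where "z = sum_list zs"
  obtain ys where ys: "set ys \<subseteq> V" "sum_list ys = z"
    and min: "\<And>xs. set xs \<subseteq> V \<Longrightarrow> sum_list xs = z \<Longrightarrow> length ys \<le> length xs"
    using ex_has_least_nat[of "\<lambda>xs. set xs \<subseteq> V \<and> sum_list xs = z" zs length] zs z_def by blast
  let ?n = "length ys" and ?L = "count_list ys"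
  have len: "(\<Sum>v\<in>V. count_list xs v) = length xs" if "set xs \<subseteq> V" for xs
    using that fV sum.mono_neutral_left[of V "set xs" "count_list xs"]
    by (auto simp: count_list_0_iff sum_count_set)
  obtain xs where xs: "length xs = ?n" "set xs \<subseteq> V" "\<forall>v\<in>V. count_list xs v \<le> ?L v"
    and bal: "\<And>i. i \<le> ?n \<Longrightarrow> \<exists>t\<in>{0..1::real}. \<forall>v\<in>V. real (count_list (take i xs) v) \<le> t * ?L v \<and>
       t * ?L v \<le> real (count_list (take i xs) v) + 1"
    using balanced_prefixes[OF fV, of ?n ?L] len[OF ys(1)] by auto
  \<comment> \<open>No count of \<open>xs\<close> exceeds that of \<open>ys\<close> and the lengths
    agree, so \<open>xs\<close> is a rearrangement of \<open>ys\<close>.\<close>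
  have "\<forall>v\<in>V. count_list xs v = ?L v"
  proof (rule ccontr)
    assume "\<not> ?thesis"
    then have "(\<Sum>v\<in>V. count_list xs v) < (\<Sum>v\<in>V. ?L v)"
      using xs(3) fV by (intro sum_strict_mono_ex1) (auto simp: nat_less_le)
    then show False using len xs ys by simp
  qed
  then have z_sum: "sum_list xs = z"
    unfolding ys(2)[symmetric] vec_eq_iff
    using sum_list_component_count[OF fV xs(2)] sum_list_component_count[OF fV ys(1)] by simp
  define s where "s i = sum_list (take i xs)" for i
  have no_repeat: False if "i < j" "j \<le> ?n" "s i = s j" for i j
  proof -
    let ?ws = "take i xs @ drop j xs"
    have "sum_list ?ws = s j + sum_list (drop j xs)" using that(3) by (simp add: s_def)
    also have "\<dots> = sum_list (take j xs @ drop j xs)" unfolding s_def by (rule sum_list_append[symmetric])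
    finally have "sum_list ?ws = z" using z_sum by simp
    moreover have "set ?ws \<subseteq> V" using xs(2) by (auto dest: in_set_takeD in_set_dropD)
    ultimately have "?n \<le> length ?ws" by (intro min)
    then show False using that xs(1) by simp
  qed
  have "inj_on s {..?n}"
  proof (rule inj_onI)
    fix i j assume "i \<in> {..?n}" "j \<in> {..?n}" "s i = s j"
    then show "i = j" using no_repeat[of i j] no_repeat[of j i] by (cases i j rule: linorder_cases) auto
  qed
  \<comment> \<open>The empty prefix is counted too, which makes the final bound on the length
    strict.\<close>
  then have card_s: "card (s ` {..?n}) = Suc ?n" by (simp add: card_image)
  \<comment> \<open>Balanced counts deviate from \<open>t * ?L v\<close> only downwards, by at most
    1. Hence coordinate \<open>k\<close> of a partial sum falls below \<open>t * z $ k\<close> by at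
    most the sum of the positive parts and exceeds it by at most the sum of the negative parts. The
    one-sided error keeps the width at \<open>\<Sum>v\<in>V. \<bar>v $ k\<bar>\<close> instead of
    twice that.\<close>
  define P where "P k = (\<Sum>v\<in>V. max 0 (v $ k))" for k
  define N where "N k = (\<Sum>v\<in>V. max 0 (- v $ k))" for k
  define lo where "lo k = min 0 (z $ k) - P k" for k
  define hi where "hi k = max 0 (z $ k) + N k" for k
  have width: "hi k - lo k + 1 = 1 + (\<Sum>v\<in>V. \<bar>v $ k\<bar>) + \<bar>z $ k\<bar>" for k
  proof -
    have "P k + N k = (\<Sum>v\<in>V. \<bar>v $ k\<bar>)"
      unfolding P_def N_def sum.distrib[symmetric] by (intro sum.cong) auto
    then show ?thesis unfolding lo_def hi_def by linarith
  qed
  have "s i $ k \<in> {lo k..hi k}" if i: "i \<le> ?n" for i k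
  proof -
    obtain t where t: "t \<in> {0..1::real}" "\<And>v. v \<in> V \<Longrightarrow> real (count_list (take i xs) v) \<le> t * ?L v"
       "\<And>v. v \<in> V \<Longrightarrow> t * ?L v \<le> real (count_list (take i xs) v) + 1"
      using bal[OF i] by blast
    define e where "e v = real (count_list (take i xs) v) - t * ?L v" for v
    have e: "- 1 \<le> e v" "e v \<le> 0" if "v \<in> V" for v using t(2,3)[OF that] by (auto simp: e_def)
    have tk: "set (take i xs) \<subseteq> V" using xs(2) by (auto dest: in_set_takeD)
    have "real_of_int (s i $ k) - t * real_of_int (z $ k) = (\<Sum>v\<in>V. e v * real_of_int (v $ k))"
      unfolding s_def ys(2)[symmetric] sum_list_component_count[OF fV tk] sum_list_component_count[OF fV ys(1)]
      by (simp add: e_def sum_distrib_left left_diff_distrib sum_subtractf mult.assoc)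
    moreover have "e v * real_of_int (v $ k) \<le> max 0 (- real_of_int (v $ k))
        \<and> - max 0 (real_of_int (v $ k)) \<le> e v * real_of_int (v $ k)" if "v \<in> V" for v
    proof (cases "v $ k \<ge> 0")
      case True
      then show ?thesis
        using mult_right_mono[of "-1" "e v" "real_of_int (v $ k)"]
          mult_right_mono[of "e v" 0 "real_of_int (v $ k)"] e[OF that] by auto
    next
      case False
      then show ?thesis
        using mult_right_mono_neg[of "-1" "e v" "real_of_int (v $ k)"]
          mult_right_mono_neg[of "e v" 0 "real_of_int (v $ k)"] e[OF that] by auto
    qed
    then have "(\<Sum>v\<in>V. e v * real_of_int (v $ k)) \<le> (\<Sum>v\<in>V. max 0 (- real_of_int (v $ k)))"
      "(\<Sum>v\<in>V. - max 0 (real_of_int (v $ k))) \<le> (\<Sum>v\<in>V. e v * real_of_int (v $ k))"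
      by (blast intro: sum_mono)+
    moreover have "(\<Sum>v\<in>V. max 0 (- real_of_int (v $ k))) = real_of_int (N k)"
      "(\<Sum>v\<in>V. - max 0 (real_of_int (v $ k))) = - real_of_int (P k)"
      by (simp_all add: N_def P_def sum_negf of_int_max)
    ultimately have "- real_of_int (P k) \<le> real_of_int (s i $ k) - t * real_of_int (z $ k)"
      "real_of_int (s i $ k) - t * real_of_int (z $ k) \<le> real_of_int (N k)" by linarith+
    from between_scaled_bounds[OF t(1) this]
    have "real_of_int (lo k) \<le> real_of_int (s i $ k)" "real_of_int (s i $ k) \<le> real_of_int (hi k)"
      by (simp_all add: lo_def hi_def of_int_max of_int_min)
    then show ?thesis by simp
  qed
  then have "s ` {..?n} \<subseteq> {x. \<forall>k. x $ k \<in> {lo k..hi k}}" by auto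
  then have "card (s ` {..?n}) \<le> card {x :: int ^ 'd. \<forall>k. x $ k \<in> {lo k..hi k}}"
    by (intro card_mono card_int_vec_box(1))
  also have "\<dots> \<le> (\<Prod>k\<in>UNIV. nat (hi k - lo k + 1))" by (rule card_int_vec_box(2))
  finally show ?thesis unfolding card_s width using ys z_def by (intro exI[of _ ys]) auto
qed

section \<open>Closed walks, simple cycles and flow conservation\<close>

text \<open>A closed walk with a repeated tail splits into the part between the two visits and the
  rest, both closed and shorter. The order of the arcs is lost, but displacements depend only on
  their multiset.\<close>

lemma (in wf_digraph) closed_walk_decomposition:
  assumes "awalk u p u"
  shows "\<exists>ps. (\<forall>r\<in>set ps. (\<exists>w. awalk w r w) \<and> distinct (map (tail G) r)) \<and> mset (concat ps) = mset p"
  using assms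
proof (induction "length p" arbitrary: p u rule: less_induct)
  case less
  show ?case
  proof (cases "distinct (map (tail G) p)")
    case True
    then show ?thesis using less.prems by (intro exI[of _ "[p]"]) auto
  next
    case False
    then obtain i j where ij: "i < j" "j < length p" "tail G (p ! i) = tail G (p ! j)"
      by (auto simp: distinct_conv_nth) (metis linorder_neqE_nat)
    define xs ys zs where "xs = take i p" and "ys = take (j - i) (drop i p)" and "zs = drop j p"
    have p: "p = xs @ ys @ zs"
      unfolding xs_def ys_def zs_def using ij
      by (metis append_assoc append_take_drop_id le_add_diff_inverse less_imp_le take_add)
    have ne: "ys \<noteq> []" "zs \<noteq> []" "hd ys = p ! i" "hd zs = p ! j"
      using ij by (auto simp: ys_def zs_def hd_drop_conv_nth)
    from less.prems have w: "awalk u xs (awlast u xs)" "awalk (awlast u xs) ys (awlast (awlast u xs) ys)"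
      "awalk (awlast (awlast u xs) ys) zs u" unfolding p by auto
    \<comment> \<open>\<open>ys\<close> and \<open>zs\<close> start with \<open>p ! i\<close> and
      \<open>p ! j\<close>, so the walk is at the same vertex at both cuts: \<open>ys\<close> is
      closed, and \<open>xs\<close> can be continued by \<open>zs\<close>.\<close>
    have "awlast u xs = tail G (p ! i)" using w(2) ne by (cases ys) (auto simp: awalk_Cons_iff)
    moreover have "awlast (awlast u xs) ys = tail G (p ! j)" using w(3) ne by (cases zs) (auto simp: awalk_Cons_iff)
    ultimately have "awalk (awlast u xs) ys (awlast u xs)" "awalk u (xs @ zs) u"
      using w ij(3) by (auto intro: awalk_appendI)
    moreover have "length ys < length p" "length (xs @ zs) < length p" using p ne by auto
    ultimately obtain ps1 ps2 where
      "\<forall>r\<in>set ps1. (\<exists>w. awalk w r w) \<and> distinct (map (tail G) r)" "mset (concat ps1) = mset ys"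
      "\<forall>r\<in>set ps2. (\<exists>w. awalk w r w) \<and> distinct (map (tail G) r)" "mset (concat ps2) = mset (xs @ zs)"
      using less.hyps[of ys] less.hyps[of "xs @ zs"] by blast
    then show ?thesis by (intro exI[of _ "ps1 @ ps2"]) (auto simp: p)
  qed
qed

text \<open>Inflow and outflow of a walk can differ only at its ends. Allowing different ends makes
  induction over the arcs possible; for a closed walk the two end terms cancel.\<close>

lemma (in wf_digraph) count_in_out_arcs_awalk:
  assumes "finite (arcs G)" "awalk u p v"
  shows "(\<Sum>e\<in>in_arcs G x. count_list p e) + of_bool (x = u) =
    (\<Sum>e\<in>out_arcs G x. count_list p e) + of_bool (x = v)"
  using assms(2)
proof (induction p arbitrary: u)
  case Nil
  then show ?case by (simp add: awalk_Nil_iff)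
next
  case (Cons e p)
  have fin: "finite (in_arcs G x)" "finite (out_arcs G x)"
    using assms(1) by (auto intro: finite_subset[OF _ assms(1)] simp: in_arcs_def out_arcs_def)
  have e: "e \<in> arcs G" "u = tail G e" "awalk (head G e) p v" using Cons.prems by (auto simp: awalk_Cons_iff)
  have split: "(\<Sum>f\<in>S. count_list (e # p) f) = of_bool (e \<in> S) + (\<Sum>f\<in>S. count_list p f)"
    if "finite S" for S
  proof -
    have "(\<Sum>f\<in>S. count_list (e # p) f) = (\<Sum>f\<in>S. (if f = e then 1 else 0) + count_list p f)"
      by (intro sum.cong) auto
    then show ?thesis using that by (simp add: sum.distrib)
  qed
  show ?case
    using Cons.IH[OF e(3)] e(1,2) unfolding split[OF fin(1)] split[OF fin(2)]
    by (auto simp: in_arcs_def out_arcs_def of_bool_def split: if_splits)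
qed

lemma count_list_concat: "count_list (concat ps) t = (\<Sum>p\<leftarrow>ps. count_list p t)"
  by (induction ps) auto

lemma distinct_count_list_le: "distinct xs \<Longrightarrow> count_list xs x \<le> 1"
  by (induction xs) (auto simp: count_list_0_iff)

lemma displacement_count_list:
  assumes "finite T" "set p \<subseteq> T"
  shows "displacement T (count_list p) = (\<Sum>t\<leftarrow>p. transition_label t)"
  using assms(2)
proof (induction p)
  case Nil
  then show ?case by (simp add: displacement_def)
next
  case (Cons e p)
  have "displacement T (count_list (e # p)) =
    (\<Sum>t\<in>T. (if t = e then transition_label t else 0) + int (count_list p t) *s transition_label t)"
    unfolding displacement_def by (intro sum.cong) (auto simp: vec_eq_iff algebra_simps)
  also have "\<dots> = transition_label e + displacement T (count_list p)"
    using assms(1) Cons.prems by (simp add: sum.distrib displacement_def)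
  finally show ?case using Cons by (simp del: count_list.simps)
qed

section \<open>Norm estimates\<close>

lemma vec_norm_component: "\<bar>z $ i\<bar> \<le> int (vec_norm z)"
proof -
  have "nat \<bar>z $ i\<bar> \<le> vec_norm z" unfolding vec_norm_def by (intro Max_ge) auto
  then show ?thesis by simp
qed

lemma vas_norm_component:
  assumes "finite A" "v \<in> A"
  shows "\<bar>v $ i\<bar> \<le> int (vas_norm A)"
proof -
  have "vec_norm v \<le> vas_norm A" using assms by (auto simp: vas_norm_def)
  then show ?thesis using vec_norm_component[of v i] by linarith
qed

lemma abs_sum_list_component_le:
  fixes xs :: "(int ^ 'd::finite) list"
  assumes "\<And>x. x \<in> set xs \<Longrightarrow> \<bar>x $ i\<bar> \<le> b"
  shows "\<bar>sum_list xs $ i\<bar> \<le> int (length xs) * b"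
  using assms
proof (induction xs)
  case (Cons x xs)
  then have "\<bar>x $ i\<bar> \<le> b" "\<bar>sum_list xs $ i\<bar> \<le> int (length xs) * b" by auto
  then show ?case by (simp add: distrib_right)
qed simp

text \<open>Together with \<open>0\<close>, the set \<open>V\<close> fits into a box of
  \<open>(1 + 2 * b) ^ CARD('d)\<close> points, so \<open>card V\<close> is smaller by at least one.
  This saves the \<open>int b\<close> on the left, which later pays for the summand \<open>1\<close>
  in the length bound.\<close>

lemma sum_abs_nonzero_vectors_le:
  fixes V :: "(int ^ 'd::finite) set" and b :: nat
  assumes "0 \<notin> V" and V: "\<And>v k. v \<in> V \<Longrightarrow> \<bar>v $ k\<bar> \<le> int b"
  shows "finite V" and "(\<Sum>v\<in>V. \<bar>v $ k\<bar>) + int b \<le> int (b * (1 + 2 * b) ^ CARD('d))"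
proof -
  let ?B = "{x :: int ^ 'd. \<forall>k. x $ k \<in> {- int b..int b}}"
  have sub: "insert 0 V \<subseteq> ?B" using V by (auto simp: abs_le_iff) (metis minus_le_iff)
  have fin: "finite ?B" by (rule card_int_vec_box(1))
  then show fV: "finite V" using sub finite_subset by (metis finite_insert)
  have "Suc (card V) = card (insert 0 V)" using assms(1) fV by simp
  also have "\<dots> \<le> card ?B" using card_mono[OF fin sub] .
  also have "\<dots> \<le> (\<Prod>k\<in>(UNIV :: 'd set). nat (int b - - int b + 1))" by (rule card_int_vec_box(2))
  also have "nat (int b - - int b + 1) = 1 + 2 * b" by simp
  finally have "b * Suc (card V) \<le> b * (1 + 2 * b) ^ CARD('d)" by (intro mult_left_mono) auto
  moreover have "(\<Sum>v\<in>V. \<bar>v $ k\<bar>) \<le> int (b * card V)"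
    using sum_bounded_above[of V "\<lambda>v. \<bar>v $ k\<bar>" "int b"] V by (simp add: mult.commute)
  ultimately show "(\<Sum>v\<in>V. \<bar>v $ k\<bar>) + int b \<le> int (b * (1 + 2 * b) ^ CARD('d))"
    by (simp flip: of_nat_add of_nat_mult of_nat_power)
qed

section \<open>Kirchhoff functions from lists of cycles\<close>

text \<open>The Kirchhoff condition is additive, and the arc counts of each closed walk satisfy
  it.\<close>

lemma kirchhoff_function_count_list_concat:
  assumes "wf_digraph (graph_of Q T)" "finite T"
    and "\<And>p. p \<in> set ps \<Longrightarrow> \<exists>w. pre_digraph.awalk (graph_of Q T) w p w"
  shows "kirchhoff_function Q T (count_list (concat ps))"
  using assms(3)
proof (induction ps)
  case Nil
  then show ?case by (simp add: kirchhoff_function_def)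
next
  case (Cons p ps)
  have fin: "finite (arcs (graph_of Q T))" using assms(2) by (simp add: graph_of_def)
  obtain w where "pre_digraph.awalk (graph_of Q T) w p w" using Cons.prems by auto
  from wf_digraph.count_in_out_arcs_awalk[OF assms(1) fin this] Cons
  show ?case by (simp add: kirchhoff_function_def sum.distrib)
qed

section \<open>The bound for witness graphs\<close>

theorem theorem6p3:
  fixes A :: "(int ^ 'd::finite) set"
    and Q :: "'d star_vec set"
    and T :: "'d transition set"
    and z :: "int ^ 'd"
    and q a m :: nat
  assumes "finite A"
    and "witness_graph A Q T"
    and "q = card Q"
    and "a = vas_norm A"
    and "z \<in> cycle_sums Q T"
    and "m = vec_norm z"
  shows "\<exists>\<mu>. kirchhoff_function Q T \<mu> \<and> displacement T \<mu> = z \<and>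
    kirchhoff_norm T \<mu> \<le> (q ^ (CARD('d) + 1) * a * (1 + 2 * a) ^ CARD('d) + m) ^ CARD('d)"
proof -
  have sub: "subreachability_graph A Q T" using assms(2) by (simp add: witness_graph_def)
  then have fQ: "finite Q" "Q \<noteq> {}" and fT: "finite T" by (simp_all add: subreachability_graph_def)
  obtain I where I: "\<forall>(x, v, y)\<in>T. x \<in> Q \<and> v \<in> A \<and> y \<in> Q \<and> y = star_add x (star_proj I v)"
    using sub unfolding subreachability_graph_def by (elim conjE exE)
  have TQ: "x \<in> Q \<and> v \<in> A \<and> y \<in> Q" if "(x, v, y) \<in> T" for x v y
    using bspec[OF I that] unfolding prod.case by blast
  define G where "G = graph_of Q T"
  have G: "verts G = Q" "arcs G = T" "tail G = (\<lambda>(x, a, y). x)" "head G = (\<lambda>(x, a, y). y)"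
    by (simp_all add: G_def graph_of_def)
  interpret wf_digraph G by unfold_locales (use TQ in \<open>auto simp: G\<close>)
  have q: "q \<ge> 1" using fQ assms(3) by (simp add: Suc_leI card_gt_0_iff)
  define disp :: "'d transition list \<Rightarrow> int ^ 'd" where "disp p = (\<Sum>t\<leftarrow>p. transition_label t)" for p
  define simple where "simple p \<longleftrightarrow> (\<exists>w. awalk w p w) \<and> distinct (map (tail G) p)" for p
  have simple_T: "set p \<subseteq> T" if "simple p" for p using that by (auto simp: simple_def awalk_def G)
  have simple_disp: "\<bar>disp p $ k\<bar> \<le> int (q * a)" if "simple p" for p k
  proof -
    have "\<bar>v $ k\<bar> \<le> int a" if "v \<in> set (map transition_label p)" for v
      using that simple_T[OF \<open>simple p\<close>] TQ vas_norm_component[OF assms(1)] assms(4)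
      by (fastforce simp: transition_label_def)
    then have "\<bar>disp p $ k\<bar> \<le> int (length p) * int a"
      unfolding disp_def using abs_sum_list_component_le[of "map transition_label p"] by simp
    moreover have "length p \<le> q"
    proof -
      have "length p = card (set (map (tail G) p))" using that distinct_card by (fastforce simp: simple_def)
      also have "\<dots> \<le> card Q" using simple_T[OF that] TQ fQ(1) by (intro card_mono) (auto simp: G)
      finally show ?thesis using assms(3) by simp
    qed
    ultimately show ?thesis
      using mult_right_mono[of "int (length p)" "int q" "int a"] by simp
  qed
  define V where "V = disp ` Collect simple - {0}"
  have V: "0 \<notin> V" "\<And>v k. v \<in> V \<Longrightarrow> \<bar>v $ k\<bar> \<le> int (q * a)" using simple_disp by (auto simp: V_def)
  note bounds = sum_abs_nonzero_vectors_le[OF V]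
  have single: "\<exists>ps. (\<forall>r\<in>set ps. simple r) \<and> (\<Sum>p\<leftarrow>ps. disp p) = sum_list \<sigma>" if cyc: "labels_cycle Q T \<sigma>" for \<sigma>
  proof -
    obtain c p where p: "awalk c p c" "map transition_label p = \<sigma>"
      using cyc unfolding labels_cycle_def G_def by blast
    obtain ps where ps: "\<forall>r\<in>set ps. simple r" "mset (concat ps) = mset p"
      using closed_walk_decomposition[OF p(1)] by (auto simp: simple_def)
    have "(\<Sum>p\<leftarrow>ps. disp p) = disp (concat ps)"
      by (induction ps) (auto simp: disp_def)
    \<comment> \<open>The decomposition may reorder the transitions, so the labels are compared as
      multisets.\<close>
    also have "\<dots> = sum_mset (image_mset transition_label (mset (concat ps)))"
      unfolding disp_def by (metis mset_map sum_mset_sum_list)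
    also have "\<dots> = sum_list \<sigma>"
      unfolding ps(2) p(2)[symmetric] by (metis mset_map sum_mset_sum_list)
    finally show ?thesis using ps(1) by blast
  qed
  obtain \<sigma>s where \<sigma>s: "z = (\<Sum>\<sigma>\<leftarrow>\<sigma>s. sum_list \<sigma>)" "\<forall>\<sigma>\<in>set \<sigma>s. labels_cycle Q T \<sigma>"
    using assms(5) by (auto simp: cycle_sums_def)
  have "\<exists>ps. (\<forall>r\<in>set ps. simple r) \<and> (\<Sum>p\<leftarrow>ps. disp p) = (\<Sum>\<sigma>\<leftarrow>\<sigma>s. sum_list \<sigma>)"
    using \<sigma>s(2)
  proof (induction \<sigma>s)
    case Nil
    show ?case by (intro exI[of _ "[]"]) auto
  next
    case (Cons \<sigma> \<sigma>s)
    then obtain ps where "\<forall>r\<in>set ps. simple r" "(\<Sum>p\<leftarrow>ps. disp p) = (\<Sum>\<sigma>\<leftarrow>\<sigma>s. sum_list \<sigma>)" by auto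
    moreover obtain ps' where "\<forall>r\<in>set ps'. simple r" "(\<Sum>p\<leftarrow>ps'. disp p) = sum_list \<sigma>"
      using single[of \<sigma>] Cons.prems by auto
    ultimately show ?case by (intro exI[of _ "ps' @ ps"]) auto
  qed
  then obtain ps where ps: "\<forall>r\<in>set ps. simple r" "(\<Sum>p\<leftarrow>ps. disp p) = z" using \<sigma>s(1) by auto
  define zs where "zs = filter (\<lambda>v. v \<noteq> 0) (map disp ps)"
  have "sum_list (filter (\<lambda>v. v \<noteq> 0) xs) = sum_list xs" for xs :: "(int ^ 'd) list"
    by (induction xs) auto
  then have zs: "sum_list zs = z" "set zs \<subseteq> V" using ps by (auto simp: zs_def V_def)
  obtain ys where ys: "set ys \<subseteq> V" "sum_list ys = z"
    "length ys < (\<Prod>k\<in>UNIV. nat (1 + (\<Sum>v\<in>V. \<bar>v $ k\<bar>) + \<bar>z $ k\<bar>))"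
    using short_representation[OF bounds(1) zs(2)] zs(1) by auto
  \<comment> \<open>One simple cycle is fixed for each displacement; a vector repeated in
    \<open>ys\<close> repeats its cycle.\<close>
  define c where "c = inv_into (Collect simple) disp"
  have c: "simple (c v) \<and> disp (c v) = v" if "v \<in> V" for v
  proof -
    have "v \<in> disp ` Collect simple" using that by (simp add: V_def)
    from inv_into_into[OF this] f_inv_into_f[OF this] show ?thesis by (simp add: c_def)
  qed
  define cs where "cs = map c ys"
  have cs: "\<forall>p\<in>set cs. simple p" using c ys(1) by (auto simp: cs_def)
  let ?\<mu> = "count_list (concat cs)"
  have "kirchhoff_function Q T ?\<mu>"
    using cs fT by (intro kirchhoff_function_count_list_concat) (auto simp: simple_def simp flip: G_def intro: wf_digraph_axioms)
  moreover have "displacement T ?\<mu> = z"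
  proof -
    have "displacement T ?\<mu> = disp (concat cs)"
      unfolding disp_def using cs simple_T fT by (intro displacement_count_list) auto
    also have "\<dots> = (\<Sum>p\<leftarrow>cs. disp p)" by (induction cs) (auto simp: disp_def)
    also have "map disp cs = ys" unfolding cs_def using c ys(1) by (simp add: map_idI subset_iff)
    finally show ?thesis using ys(2) by simp
  qed
  moreover have "?\<mu> t \<le> (q ^ (CARD('d) + 1) * a * (1 + 2 * a) ^ CARD('d) + m) ^ CARD('d)" for t
  \<comment> \<open>Absorbing the summand \<open>1\<close> takes \<open>q * a \<ge> 1\<close>, which
    a nonzero displacement guarantees. If there is none, \<open>ys\<close> is empty and
    \<open>?\<mu>\<close> vanishes.\<close>
  proof (cases "V = {}")
    case True
    then show ?thesis using ys(1) by (simp add: cs_def)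
  next
    case False
    then obtain v where "v \<in> V" by auto
    have "a \<noteq> 0"
    proof
      assume "a = 0"
      then have "v = 0" using V(2)[OF \<open>v \<in> V\<close>] by (simp add: vec_eq_iff)
      then show False using V(1) \<open>v \<in> V\<close> by simp
    qed
    \<comment> \<open>A simple cycle has distinct tails and so uses each transition at most once;
      hence \<open>?\<mu> t\<close> is at most the number of cycles.\<close>
    have "count_list p t \<le> 1" if "simple p" for p
    proof -
      have "distinct p" using that by (simp add: simple_def distinct_map)
      then show ?thesis by (rule distinct_count_list_le)
    qed
    then have "?\<mu> t \<le> length cs"
      using cs sum_list_mono[of cs "\<lambda>p. count_list p t" "\<lambda>p. 1"]
      by (auto simp: count_list_concat sum_list_triv)
    also have "\<dots> \<le> (\<Prod>k\<in>UNIV. nat (1 + (\<Sum>v\<in>V. \<bar>v $ k\<bar>) + \<bar>z $ k\<bar>))"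
      using ys(3) by (simp add: cs_def)
    also have "\<dots> \<le> (\<Prod>k\<in>(UNIV :: 'd set). q ^ (CARD('d) + 1) * a * (1 + 2 * a) ^ CARD('d) + m)"
    proof (intro prod_mono conjI)
      fix k :: 'd
      have "1 \<le> q * a" using q \<open>a \<noteq> 0\<close> by simp
      then have "1 \<le> int (q * a)" by linarith
      then have "1 + (\<Sum>v\<in>V. \<bar>v $ k\<bar>) \<le> int (q * a * (1 + 2 * (q * a)) ^ CARD('d))"
        using bounds(2)[of k] by linarith
      \<comment> \<open>Since \<open>q \<ge> 1\<close>,
        \<open>1 + 2 * (q * a) \<le> q * (1 + 2 * a)\<close>. The \<open>CARD('d)\<close> factors
        \<open>q\<close> obtained this way and the one in \<open>q * a\<close> make up the exponent
        \<open>CARD('d) + 1\<close>.\<close>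
      moreover have "q * a * (1 + 2 * (q * a)) ^ CARD('d) \<le> q * a * (q * (1 + 2 * a)) ^ CARD('d)"
        using q by (intro mult_left_mono power_mono) (auto simp: algebra_simps)
      moreover have "\<dots> = q ^ (CARD('d) + 1) * a * (1 + 2 * a) ^ CARD('d)"
        by (simp only: power_mult_distrib power_add power_one_right mult_ac)
      ultimately show "nat (1 + (\<Sum>v\<in>V. \<bar>v $ k\<bar>) + \<bar>z $ k\<bar>) \<le> q ^ (CARD('d) + 1) * a * (1 + 2 * a) ^ CARD('d) + m"
        using vec_norm_component[of z k] unfolding assms(6) by linarith
    qed simp
    finally show ?thesis by simp
  qed
  then have "kirchhoff_norm T ?\<mu> \<le> (q ^ (CARD('d) + 1) * a * (1 + 2 * a) ^ CARD('d) + m) ^ CARD('d)"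
    using fT by (simp add: kirchhoff_norm_def)
  ultimately show ?thesis by blast
qed

end
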